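(* Let $(\Omega,\mathcal A,P)$ be a probability space, let $(\Omega_i,\mathcal A_i)$, $i=1,2,3,4$, be measurable spaces, and let $X_i:(\Omega,\mathcal A,P)\to(\Omega_i,\mathcal A_i)$, $i=1,2,3,4$, be random variables. Suppose that $X_4=f\circ X_3$, where $f:(\Omega_3,\mathcal A_3)\to(\Omega_4,\mathcal A_4)$ is measurable. Assume that all the conditional distributions appearing below (of random variables, and of Markov kernels) exist. Consider the propositions: (i) $X_1$ and $X_2$ are conditionally independent given $X_3$ (with respect to $P$). (ii) $X_1$ and $X_2$ are conditionally independent given $X_4$ (with respect to $P$). (iii) The Markov kernels $P^{X_1|X_3}$ and $P^{X_2|X_3}$, defined on the probability space $(\Omega_3,\mathcal A_3,P^{X_3})$, are conditionally independent given the Markov kernel $P^{X_4|X_3}$, with respect to $P^{X_3}$. Then, if (i) holds, the propositions (ii) and (iii) are equivalent.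
   Context: A random variable is a measurable map between measurable spaces. For a random variable $X:(\Omega,\mathcal A)\to(\Omega_1,\mathcal A_1)$ and a probability measure $P$ on $\mathcal A$, $P^X$ denotes the distribution $P^X(A_1)=P(X^{-1}(A_1))$. The symbol $\times$ denotes products of $\sigma$-fields and of measures. Markov kernel: a Markov kernel $M$ from $(\Omega,\mathcal A)$ to $(\Omega_1,\mathcal A_1)$ is a map $M:\Omega\times\mathcal A_1\to[0,1]$ such that $M(\omega,\cdot)$ is a probability measure on $\mathcal A_1$ for every $\omega\in\Omega$ and $M(\cdot,A_1)$ is $\mathcal A$-measurable for every $A_1\in\mathcal A_1$. Diagonal product: for Markov kernels $M_1$ from $(\Omega,\mathcal A)$ to $(\Omega_1,\mathcal A_1)$ and $M_2$ from $(\Omega,\mathcal A)$ to $(\Omega_2,\mathcal A_2)$, $M_1\times M_2$ is the unique Markov kernel from $(\Omega,\mathcal A)$ to $(\Omega_1\times\Omega_2,\mathcal A_1\times\mathcal A_2)$ with $(M_1\times M_2)(\omega,A_1\times A_2)=M_1(\omega,A_1)\,M_2(\omega,A_2)$ for all $A_i\in\mathcal A_i$. Image of a kernel: for a probability measure $Q$ on $\mathcal A$ and a Markov kernel $M$ from $(\Omega,\mathcal A)$ to $(\Omega_1,\mathcal A_1)$, $Q^{M}(A_1):=\int_\Omega M(\omega,A_1)\,dQ(\omega)$, $A_1\in\mathcal A_1$. Conditional distribution of random variables: for random variables $X,Y$ on $(\Omega,\mathcal A,P)$ with values in $(\Omega_X,\mathcal A_X)$ and $(\Omega_Y,\mathcal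 A_Y)$, the conditional distribution $P^{Y|X}$ of $Y$ given $X$, when it exists, is a Markov kernel from $(\Omega_X,\mathcal A_X)$ to $(\Omega_Y,\mathcal A_Y)$, written $P^{Y|X=x}(B)$, such that $P(X\in A,Y\in B)=\int_A P^{Y|X=x}(B)\,dP^X(x)$ for all $A\in\mathcal A_X$, $B\in\mathcal A_Y$. Conditional independence of random variables: $X_1$ and $X_2$ are conditionally independent given $X_3$ if $P^{(X_1,X_2)|X_3}=P^{X_1|X_3}\times P^{X_2|X_3}$, $P^{X_3}$-almost surely (and likewise with $X_4$ in place of $X_3$). Conditional distribution of a kernel given another: for Markov kernels $N_1,N_2$ from $(\Omega,\mathcal A,Q)$ to $(\Omega_1,\mathcal A_1)$ and $(\Omega_2,\mathcal A_2)$ respectively, the conditional distribution $Q^{N_1|N_2}$ of $N_1$ given $N_2$, when it exists, is a Markov kernel $L$ from $(\Omega_2,\mathcal A_2)$ to $(\Omega_1,\mathcal A_1)$ such that $\int_\Omega N_1(\omega,A_1)N_2(\omega,A_2)\,dQ(\omega)=\int_{A_2}L(\omega_2,A_1)\,dQ^{N_2}(\omega_2)$ for all $A_1\in\mathcal A_1$, $A_2\in\mathcal A_2$. Conditional independence of kernels: given Markov kernels $M_1,M_2,M_3$ on a probability space with probability measure $Q$, $M_1$ and $M_2$ are conditionally independent given $M_3$ with respect to $Q$ if $Q^{M_1\times M_2|M_3}=Q^{M_1|M_3}\times Q^{M_2|M_3}$, $Q^{M_3}$-almost surely, the right-hand side being the diagonal product. In all these definitions, almost sure equality of kernels is understood in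 the sense that for all measurable $A_1\in\mathcal A_1$, $A_2\in\mathcal A_2$ the two kernels evaluated at $A_1\times A_2$ agree almost everywhere. With $Q=P^{X_3}$ and $M_i=P^{X_i|X_3}$ ($i=1,2,4$), proposition (iii) says $Q^{M_1\times M_2|M_4}=Q^{M_1|M_4}\times Q^{M_2|M_4}$, $Q^{M_4}$-almost surely. *)

theory Defs
  imports "HOL-Probability.Probability"
begin

text \<open>
  A Markov kernel from \<open>M\<close> to \<open>N\<close> is an element of \<open>M \<rightarrow>\<^sub>M prob_algebra N\<close>, and the image
  measure \<open>Q\<^sup>K\<close> of a kernel is the monadic bind \<open>Q \<bind> K\<close> (see \<open>emeasure_bind\<close>).
  Conditional distributions are unique only up to almost sure equality on each measurable set,
  so they are given by predicates stating that a kernel is a version of them.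
\<close>

definition diag_prod ::
  "('a \<Rightarrow> 'b measure) \<Rightarrow> ('a \<Rightarrow> 'c measure) \<Rightarrow> 'a \<Rightarrow> ('b \<times> 'c) measure"
  where "diag_prod K L = (\<lambda>x. K x \<Otimes>\<^sub>M L x)"

text \<open>\<open>K\<close> is a version of the conditional distribution of \<open>Y\<close> given \<open>X\<close>.\<close>

definition is_cond_distr ::
  "'w measure \<Rightarrow> 'a measure \<Rightarrow> ('w \<Rightarrow> 'a) \<Rightarrow> 'b measure \<Rightarrow> ('w \<Rightarrow> 'b) \<Rightarrow> ('b \<Rightarrow> 'a measure) \<Rightarrow> bool"
  where "is_cond_distr P MY Y MX X K \<longleftrightarrow>
    K \<in> MX \<rightarrow>\<^sub>M prob_algebra MY \<and>
    (\<forall>A\<in>sets MX. \<forall>B\<in>sets MY.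
      emeasure P {\<omega> \<in> space P. X \<omega> \<in> A \<and> Y \<omega> \<in> B} =
      (\<integral>\<^sup>+x\<in>A. emeasure (K x) B \<partial>distr P MX X))"

text \<open>\<open>L\<close> is a version of the conditional distribution of the kernel \<open>N1\<close> given the kernel \<open>N2\<close>.\<close>

definition is_kernel_cond_distr ::
  "'w measure \<Rightarrow> 'a measure \<Rightarrow> ('w \<Rightarrow> 'a measure) \<Rightarrow> 'b measure \<Rightarrow> ('w \<Rightarrow> 'b measure)
    \<Rightarrow> ('b \<Rightarrow> 'a measure) \<Rightarrow> bool"
  where "is_kernel_cond_distr Q M1 N1 M2 N2 L \<longleftrightarrow>
    L \<in> M2 \<rightarrow>\<^sub>M prob_algebra M1 \<and>
    (\<forall>A1\<in>sets M1. \<forall>A2\<in>sets M2.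
      (\<integral>\<^sup>+\<omega>. emeasure (N1 \<omega>) A1 * emeasure (N2 \<omega>) A2 \<partial>Q) =
      (\<integral>\<^sup>+x\<in>A2. emeasure (L x) A1 \<partial>(Q \<bind> N2)))"

text \<open>The exceptional null set may depend on the measurable rectangle.\<close>

definition kernel_AE_eq ::
  "'c measure \<Rightarrow> 'a measure \<Rightarrow> 'b measure
    \<Rightarrow> ('c \<Rightarrow> ('a \<times> 'b) measure) \<Rightarrow> ('c \<Rightarrow> ('a \<times> 'b) measure) \<Rightarrow> bool"
  where "kernel_AE_eq Q M1 M2 K L \<longleftrightarrow>
    (\<forall>A1\<in>sets M1. \<forall>A2\<in>sets M2.
      AE x in Q. emeasure (K x) (A1 \<times> A2) = emeasure (L x) (A1 \<times> A2))"

text \<open>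
  In the next two definitions the choice of versions is immaterial: when versions exist, almost
  sure equality for one choice is equivalent to almost sure equality for every choice.
\<close>

definition cond_indep_rv ::
  "'w measure \<Rightarrow> 'a measure \<Rightarrow> ('w \<Rightarrow> 'a) \<Rightarrow> 'b measure \<Rightarrow> ('w \<Rightarrow> 'b)
    \<Rightarrow> 'c measure \<Rightarrow> ('w \<Rightarrow> 'c) \<Rightarrow> bool"
  where "cond_indep_rv P M1 X1 M2 X2 M3 X3 \<longleftrightarrow>
    (\<exists>K12 K1 K2.
      is_cond_distr P (M1 \<Otimes>\<^sub>M M2) (\<lambda>\<omega>. (X1 \<omega>, X2 \<omega>)) M3 X3 K12 \<and>
      is_cond_distr P M1 X1 M3 X3 K1 \<and>
      is_cond_distr P M2 X2 M3 X3 K2 \<and>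
      kernel_AE_eq (distr P M3 X3) M1 M2 K12 (diag_prod K1 K2))"

definition cond_indep_kernel ::
  "'w measure \<Rightarrow> 'a measure \<Rightarrow> ('w \<Rightarrow> 'a measure) \<Rightarrow> 'b measure \<Rightarrow> ('w \<Rightarrow> 'b measure)
    \<Rightarrow> 'c measure \<Rightarrow> ('w \<Rightarrow> 'c measure) \<Rightarrow> bool"
  where "cond_indep_kernel Q M1 N1 M2 N2 M3 N3 \<longleftrightarrow>
    (\<exists>L12 L1 L2.
      is_kernel_cond_distr Q (M1 \<Otimes>\<^sub>M M2) (diag_prod N1 N2) M3 N3 L12 \<and>
      is_kernel_cond_distr Q M1 N1 M3 N3 L1 \<and>
      is_kernel_cond_distr Q M2 N2 M3 N3 L2 \<and>
      kernel_AE_eq (Q \<bind> N3) M1 M2 L12 (diag_prod L1 L2))"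

end

theory Submission imports Defs begin

text \<open>
  Write \<open>Q\<close> for the distribution of \<open>X3\<close>. Conditioning on the kernel \<open>K4\<close> is the same as
  conditioning on the random variable \<open>X4\<close>. Indeed \<open>X4\<close> is the function \<open>f\<close> of \<open>X3\<close>, so the
  Dirac kernel at \<open>f x\<close> is a version of the conditional distribution of \<open>X4\<close> given \<open>X3\<close>; as
  versions are almost surely unique, \<open>K4 x A = indicator A (f x)\<close> for \<open>Q\<close>-almost every \<open>x\<close>.
  Hence for any kernel \<open>K\<close> that is a version of the conditional distribution of \<open>Y\<close> given \<open>X3\<close>,
  the integral of \<open>K x B * K4 x A\<close> with respect to \<open>Q\<close> is the integral of \<open>K x B\<close> over the
  preimage of \<open>A\<close> under \<open>f\<close>, which is the probability of the event \<open>X4 \<in> A \<and> Y \<in> B\<close>,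
  and the image of \<open>Q\<close> under \<open>K4\<close> is the distribution of \<open>X4\<close>. The equations that define a
  conditional distribution of \<open>K\<close> given \<open>K4\<close> are therefore those that define a conditional
  distribution of \<open>Y\<close> given \<open>X4\<close> (\<open>is_kernel_cond_distr_iff_is_cond_distr\<close>).

  This applies to \<open>K1\<close> with \<open>Y = X1\<close> and to \<open>K2\<close> with \<open>Y = X2\<close>. It applies to the diagonal
  product of \<open>K1\<close> and \<open>K2\<close> with \<open>Y = (X1, X2)\<close> because of the conditional independence
  given \<open>X3\<close>, which makes this product a version of the conditional distribution of the pair
  (\<open>cond_indep_rv_imp_is_cond_distr_diag_prod\<close>). Then the two conditional independence
  statements compare the same versions with respect to the same measure.
\<close>

section \<open>Markov kernels and their diagonal products\<close>

lemma kernel_measurable_emeasure: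
  assumes "K \<in> M \<rightarrow>\<^sub>M prob_algebra N" "B \<in> sets N"
  shows "(\<lambda>x. emeasure (K x) B) \<in> borel_measurable M"
  using measurable_prob_algebraD[OF assms(1)] assms(2)
  by (rule measurable_emeasure_kernel)

lemma diag_prod_measurable:
  assumes "K \<in> M \<rightarrow>\<^sub>M prob_algebra N" "L \<in> M \<rightarrow>\<^sub>M prob_algebra N'"
  shows "diag_prod K L \<in> M \<rightarrow>\<^sub>M prob_algebra (N \<Otimes>\<^sub>M N')"
  using assms unfolding diag_prod_def by measurable

lemma emeasure_diag_prod_Times:
  assumes "K \<in> M \<rightarrow>\<^sub>M prob_algebra N" "L \<in> M \<rightarrow>\<^sub>M prob_algebra N'"
    and "x \<in> space M" "A \<in> sets N" "B \<in> sets N'"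
  shows "emeasure (diag_prod K L x) (A \<times> B) = emeasure (K x) A * emeasure (L x) B"
proof -
  have K: "prob_space (K x)" "sets (K x) = sets N" and L: "prob_space (L x)" "sets (L x) = sets N'"
    using measurable_space[OF assms(1,3)] measurable_space[OF assms(2,3)]
    by (auto simp: space_prob_algebra)
  interpret L: prob_space "L x" by (fact L(1))
  show ?thesis
    unfolding diag_prod_def using assms(4,5) K(2) L(2) by (intro L.emeasure_pair_measure_Times) auto
qed

text \<open>
  Almost sure equality of kernels speaks of one rectangle at a time. After integration the
  exceptional null sets disappear, both sides are finite measures in the second argument, and
  these agree on all measurable sets since rectangles form a \<open>\<pi>\<close>-system that generates
  the product \<open>\<sigma>\<close>-field.
\<close>

lemma kernel_AE_eq_nn_integral_eq:
  assumes Q: "finite_measure Q" and ne: "space Q \<noteq> {}"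
    and K: "K \<in> Q \<rightarrow>\<^sub>M prob_algebra (M1 \<Otimes>\<^sub>M M2)" and L: "L \<in> Q \<rightarrow>\<^sub>M prob_algebra (M1 \<Otimes>\<^sub>M M2)"
    and eq: "kernel_AE_eq Q M1 M2 K L"
    and A: "A \<in> sets Q" and C: "C \<in> sets (M1 \<Otimes>\<^sub>M M2)"
  shows "(\<integral>\<^sup>+x\<in>A. emeasure (K x) C \<partial>Q) = (\<integral>\<^sup>+x\<in>A. emeasure (L x) C \<partial>Q)"
proof -
  interpret finite_measure Q by (fact Q)
  \<comment> \<open>Binding a kernel to \<open>Q\<close> restricted to \<open>A\<close> gives the measure whose value at \<open>B\<close> is the integral
    over \<open>A\<close> of the kernel at \<open>B\<close>.\<close>
  define D where "D = density Q (indicator A)"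
  have bind: "emeasure (D \<bind> J) B = (\<integral>\<^sup>+x\<in>A. emeasure (J x) B \<partial>Q)"
    and sets_bind_J: "sets (D \<bind> J) = sets (M1 \<Otimes>\<^sub>M M2)"
    if J: "J \<in> Q \<rightarrow>\<^sub>M prob_algebra (M1 \<Otimes>\<^sub>M M2)" and B: "B \<in> sets (M1 \<Otimes>\<^sub>M M2)" for J B
  proof -
    have J': "J \<in> D \<rightarrow>\<^sub>M subprob_algebra (M1 \<Otimes>\<^sub>M M2)"
      using measurable_prob_algebraD[OF J] by (simp add: D_def)
    have ne': "space D \<noteq> {}" using ne by (simp add: D_def)
    have "emeasure (D \<bind> J) B = (\<integral>\<^sup>+x. emeasure (J x) B \<partial>D)"
      using ne' J' B by (rule emeasure_bind)
    also have "\<dots> = (\<integral>\<^sup>+x. indicator A x * emeasure (J x) B \<partial>Q)"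
      unfolding D_def using A kernel_measurable_emeasure[OF J B]
      by (intro nn_integral_density) auto
    finally show "emeasure (D \<bind> J) B = (\<integral>\<^sup>+x\<in>A. emeasure (J x) B \<partial>Q)" by (simp add: mult.commute)
    show "sets (D \<bind> J) = sets (M1 \<Otimes>\<^sub>M M2)"
      by (rule sets_bind_measurable[OF J' ne'])
  qed
  let ?E = "{a \<times> b |a b. a \<in> sets M1 \<and> b \<in> sets M2}"
  let ?\<Omega> = "space M1 \<times> space M2"
  have rect: "emeasure (D \<bind> K) (a \<times> b) = emeasure (D \<bind> L) (a \<times> b)"
    if "a \<in> sets M1" "b \<in> sets M2" for a b
  proof -
    have "AE x in Q. emeasure (K x) (a \<times> b) = emeasure (L x) (a \<times> b)"
      using eq that by (auto simp: kernel_AE_eq_def)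
    then have "(\<integral>\<^sup>+x\<in>A. emeasure (K x) (a \<times> b) \<partial>Q) = (\<integral>\<^sup>+x\<in>A. emeasure (L x) (a \<times> b) \<partial>Q)"
      by (intro nn_integral_cong_AE) auto
    then show ?thesis using bind[OF K] bind[OF L] that by simp
  qed
  have fin: "emeasure (D \<bind> K) ?\<Omega> \<noteq> \<infinity>"
  proof -
    have "emeasure (D \<bind> K) ?\<Omega> = (\<integral>\<^sup>+x\<in>A. emeasure (K x) ?\<Omega> \<partial>Q)"
      by (rule bind[OF K]) auto
    also have "\<dots> \<le> (\<integral>\<^sup>+x. 1 \<partial>Q)"
    proof (rule nn_integral_mono)
      fix x assume "x \<in> space Q"
      then have "prob_space (K x)" using measurable_space[OF K] by (auto simp: space_prob_algebra)
      then have "emeasure (K x) ?\<Omega> \<le> 1" by (rule prob_space.measure_le_1)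
      then show "emeasure (K x) ?\<Omega> * indicator A x \<le> 1" by (auto split: split_indicator)
    qed
    also have "\<dots> < \<infinity>" by (simp add: less_top[symmetric])
    finally show ?thesis by simp
  qed
  have "D \<bind> K = D \<bind> L"
  proof (rule measure_eqI_generator_eq[where E = ?E and \<Omega> = ?\<Omega> and A = "\<lambda>_. ?\<Omega>"])
    show "Int_stable ?E" by (rule Int_stable_pair_measure_generator)
    show "?E \<subseteq> Pow ?\<Omega>" using sets.space_closed[of M1] sets.space_closed[of M2] by blast
    show "emeasure (D \<bind> K) X = emeasure (D \<bind> L) X" if "X \<in> ?E" for X
      using that rect by auto
    show "sets (D \<bind> K) = sigma_sets ?\<Omega> ?E" "sets (D \<bind> L) = sigma_sets ?\<Omega> ?E"
      using sets_bind_J[OF K C] sets_bind_J[OF L C] by (simp_all add: sets_pair_measure)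
    show "range (\<lambda>_. ?\<Omega>) \<subseteq> ?E" by auto
    show "emeasure (D \<bind> K) ?\<Omega> \<noteq> \<infinity>" for i :: nat by (rule fin)
  qed auto
  then show ?thesis using bind[OF K C] bind[OF L C] by simp
qed

section \<open>Versions of a conditional distribution\<close>

lemma is_cond_distr_measurable:
  "is_cond_distr P MY Y MX X K \<Longrightarrow> K \<in> MX \<rightarrow>\<^sub>M prob_algebra MY"
  by (simp add: is_cond_distr_def)

text \<open>
  The integrals of \<open>K x B\<close> and \<open>K' x B\<close> over every measurable set are prescribed by the joint
  distribution, so the two functions are densities of the same measure.
\<close>

lemma is_cond_distr_AE_unique:
  assumes "prob_space P" and X: "X \<in> P \<rightarrow>\<^sub>M MX"
    and K: "is_cond_distr P MY Y MX X K" and K': "is_cond_distr P MY Y MX X K'"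
    and B: "B \<in> sets MY"
  shows "AE x in distr P MX X. emeasure (K x) B = emeasure (K' x) B"
proof -
  interpret P: prob_space P by fact
  interpret Q: prob_space "distr P MX X" using X by (rule P.prob_space_distr)
  have meas: "(\<lambda>x. emeasure (K x) B) \<in> borel_measurable (distr P MX X)"
       "(\<lambda>x. emeasure (K' x) B) \<in> borel_measurable (distr P MX X)"
    using kernel_measurable_emeasure[OF is_cond_distr_measurable[OF K] B]
      kernel_measurable_emeasure[OF is_cond_distr_measurable[OF K'] B] by simp_all
  have "density (distr P MX X) (\<lambda>x. emeasure (K x) B) = density (distr P MX X) (\<lambda>x. emeasure (K' x) B)"
  proof (rule measure_eqI)
    fix A assume "A \<in> sets (density (distr P MX X) (\<lambda>x. emeasure (K x) B))"
    then have A: "A \<in> sets MX" by simp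
    have "(\<integral>\<^sup>+x\<in>A. emeasure (K x) B \<partial>distr P MX X) = (\<integral>\<^sup>+x\<in>A. emeasure (K' x) B \<partial>distr P MX X)"
      using K K' A B by (simp add: is_cond_distr_def)
    then show "emeasure (density (distr P MX X) (\<lambda>x. emeasure (K x) B)) A =
          emeasure (density (distr P MX X) (\<lambda>x. emeasure (K' x) B)) A"
      using A meas by (simp add: emeasure_density)
  qed simp
  then show ?thesis by (rule Q.density_unique[OF meas])
qed

lemma is_cond_distr_return:
  assumes X: "X \<in> P \<rightarrow>\<^sub>M MX" and f: "f \<in> MX \<rightarrow>\<^sub>M MY"
    and Y: "\<And>\<omega>. \<omega> \<in> space P \<Longrightarrow> Y \<omega> = f (X \<omega>)"
  shows "is_cond_distr P MY Y MX X (\<lambda>x. return MY (f x))"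
  unfolding is_cond_distr_def
proof (intro conjI ballI)
  show "(\<lambda>x. return MY (f x)) \<in> MX \<rightarrow>\<^sub>M prob_algebra MY"
    using f by measurable
  fix A B assume A: "A \<in> sets MX" and B: "B \<in> sets MY"
  have C: "A \<inter> (f -` B \<inter> space MX) \<in> sets MX" using A B f by auto
  have "(\<integral>\<^sup>+x\<in>A. emeasure (return MY (f x)) B \<partial>distr P MX X) =
      (\<integral>\<^sup>+x. indicator (A \<inter> (f -` B \<inter> space MX)) x \<partial>distr P MX X)"
    using B by (intro nn_integral_cong) (auto split: split_indicator)
  also have "\<dots> = emeasure P (X -` (A \<inter> (f -` B \<inter> space MX)) \<inter> space P)"
    using X C by (simp add: emeasure_distr)
  also have "X -` (A \<inter> (f -` B \<inter> space MX)) \<inter> space P = {\<omega> \<in> space P. X \<omega> \<in> A \<and> Y \<omega> \<in> B}"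
    using Y measurable_space[OF X] by auto
  finally show "emeasure P {\<omega> \<in> space P. X \<omega> \<in> A \<and> Y \<omega> \<in> B} =
      (\<integral>\<^sup>+x\<in>A. emeasure (return MY (f x)) B \<partial>distr P MX X)" by simp
qed

lemma bind_is_cond_distr:
  assumes "prob_space P" and X: "X \<in> P \<rightarrow>\<^sub>M MX" and Y: "Y \<in> P \<rightarrow>\<^sub>M MY"
    and K: "is_cond_distr P MY Y MX X K"
  shows "distr P MX X \<bind> K = distr P MY Y"
proof -
  interpret P: prob_space P by fact
  have ne: "space (distr P MX X) \<noteq> {}"
    using measurable_space[OF X] P.not_empty by auto
  have K': "K \<in> distr P MX X \<rightarrow>\<^sub>M subprob_algebra MY"
    using measurable_prob_algebraD[OF is_cond_distr_measurable[OF K]] by simp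
  have sets_eq: "sets (distr P MX X \<bind> K) = sets MY"
    by (rule sets_bind_measurable[OF K' ne])
  show ?thesis
  proof (rule measure_eqI)
    fix B assume "B \<in> sets (distr P MX X \<bind> K)"
    then have B: "B \<in> sets MY" by (simp add: sets_eq)
    have "emeasure (distr P MX X \<bind> K) B = (\<integral>\<^sup>+x. emeasure (K x) B \<partial>distr P MX X)"
      using ne K' B by (rule emeasure_bind)
    also have "\<dots> = (\<integral>\<^sup>+x\<in>space MX. emeasure (K x) B \<partial>distr P MX X)"
      by (intro nn_integral_cong) auto
    also have "\<dots> = emeasure P {\<omega> \<in> space P. X \<omega> \<in> space MX \<and> Y \<omega> \<in> B}"
      using K B by (simp add: is_cond_distr_def)
    also have "{\<omega> \<in> space P. X \<omega> \<in> space MX \<and> Y \<omega> \<in> B} = Y -` B \<inter> space P"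
      using measurable_space[OF X] by auto
    finally show "emeasure (distr P MX X \<bind> K) B = emeasure (distr P MY Y) B"
      using Y B by (simp add: emeasure_distr)
  qed (simp add: sets_eq)
qed

section \<open>Conditional independence\<close>

text \<open>
  On rectangles the product agrees almost surely with the product of the versions that witness
  conditional independence, hence with the joint conditional distribution; integration extends
  this to all measurable sets.
\<close>

lemma cond_indep_rv_imp_is_cond_distr_diag_prod:
  assumes P: "prob_space P" and X3: "X3 \<in> P \<rightarrow>\<^sub>M M3"
    and indep: "cond_indep_rv P M1 X1 M2 X2 M3 X3"
    and K1: "is_cond_distr P M1 X1 M3 X3 K1" and K2: "is_cond_distr P M2 X2 M3 X3 K2"
  shows "is_cond_distr P (M1 \<Otimes>\<^sub>M M2) (\<lambda>\<omega>. (X1 \<omega>, X2 \<omega>)) M3 X3 (diag_prod K1 K2)"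
proof -
  let ?Q = "distr P M3 X3"
  interpret P: prob_space P by (fact P)
  interpret Q: prob_space ?Q using X3 by (rule P.prob_space_distr)
  obtain J J1 J2 where
    J: "is_cond_distr P (M1 \<Otimes>\<^sub>M M2) (\<lambda>\<omega>. (X1 \<omega>, X2 \<omega>)) M3 X3 J" and
    J1: "is_cond_distr P M1 X1 M3 X3 J1" and J2: "is_cond_distr P M2 X2 M3 X3 J2" and
    eq: "kernel_AE_eq ?Q M1 M2 J (diag_prod J1 J2)"
    using indep unfolding cond_indep_rv_def by blast
  note meas = is_cond_distr_measurable[OF K1] is_cond_distr_measurable[OF K2]
    is_cond_distr_measurable[OF J1] is_cond_distr_measurable[OF J2]
  have prod: "diag_prod K1 K2 \<in> M3 \<rightarrow>\<^sub>M prob_algebra (M1 \<Otimes>\<^sub>M M2)"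
    by (rule diag_prod_measurable[OF meas(1,2)])
  have "kernel_AE_eq ?Q M1 M2 J (diag_prod K1 K2)"
    unfolding kernel_AE_eq_def
  proof (intro ballI)
    fix A B assume A: "A \<in> sets M1" and B: "B \<in> sets M2"
    have "AE x in ?Q. emeasure (J x) (A \<times> B) = emeasure (diag_prod J1 J2 x) (A \<times> B)"
      using eq A B by (simp add: kernel_AE_eq_def)
    moreover note is_cond_distr_AE_unique[OF P X3 J1 K1 A] is_cond_distr_AE_unique[OF P X3 J2 K2 B]
    ultimately show "AE x in ?Q. emeasure (J x) (A \<times> B) = emeasure (diag_prod K1 K2 x) (A \<times> B)"
      using AE_space
    proof eventually_elim
      case (elim x)
      then have "x \<in> space M3" by simp
      with elim show ?case
        using emeasure_diag_prod_Times[OF meas(1,2) _ A B] emeasure_diag_prod_Times[OF meas(3,4) _ A B]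
        by simp
    qed
  qed
  then have "(\<integral>\<^sup>+x\<in>A. emeasure (J x) C \<partial>?Q) = (\<integral>\<^sup>+x\<in>A. emeasure (diag_prod K1 K2 x) C \<partial>?Q)"
    if "A \<in> sets M3" "C \<in> sets (M1 \<Otimes>\<^sub>M M2)" for A C
    using that is_cond_distr_measurable[OF J] prod Q.not_empty
    by (intro kernel_AE_eq_nn_integral_eq[OF Q.finite_measure_axioms]) auto
  then show ?thesis using J prod by (simp add: is_cond_distr_def)
qed

text \<open>
  Almost surely \<open>K4\<close> is the Dirac kernel of \<open>f\<close>, so integrating \<open>K x B\<close> against \<open>K4 x A\<close> is
  integrating it over the preimage of \<open>A\<close> under \<open>f\<close>, that is, over the event \<open>X4 \<in> A\<close>.
\<close>

lemma is_kernel_cond_distr_iff_is_cond_distr: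
  assumes P: "prob_space P" and X3: "X3 \<in> P \<rightarrow>\<^sub>M M3" and X4: "X4 \<in> P \<rightarrow>\<^sub>M M4"
    and f: "f \<in> M3 \<rightarrow>\<^sub>M M4" and X4_eq: "\<And>\<omega>. \<omega> \<in> space P \<Longrightarrow> X4 \<omega> = f (X3 \<omega>)"
    and K4: "is_cond_distr P M4 X4 M3 X3 K4" and K: "is_cond_distr P MY Y M3 X3 K"
  shows "is_kernel_cond_distr (distr P M3 X3) MY K M4 K4 L \<longleftrightarrow> is_cond_distr P MY Y M4 X4 L"
proof -
  let ?Q = "distr P M3 X3"
  have lhs: "(\<integral>\<^sup>+x. emeasure (K x) B * emeasure (K4 x) A \<partial>?Q) =
      emeasure P {\<omega> \<in> space P. X4 \<omega> \<in> A \<and> Y \<omega> \<in> B}"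
    if B: "B \<in> sets MY" and A: "A \<in> sets M4" for A B
  proof -
    have "AE x in ?Q. emeasure (K4 x) A = emeasure (return M4 (f x)) A"
      using is_cond_distr_return[OF X3 f X4_eq]
      by (rule is_cond_distr_AE_unique[OF P X3 K4 _ A])
    then have "(\<integral>\<^sup>+x. emeasure (K x) B * emeasure (K4 x) A \<partial>?Q) =
        (\<integral>\<^sup>+x\<in>f -` A \<inter> space M3. emeasure (K x) B \<partial>?Q)"
      using AE_space
      by (intro nn_integral_cong_AE, eventually_elim) (use A in \<open>auto split: split_indicator\<close>)
    also have "\<dots> = emeasure P {\<omega> \<in> space P. X3 \<omega> \<in> f -` A \<inter> space M3 \<and> Y \<omega> \<in> B}"
      using K B measurable_sets[OF f A] by (simp add: is_cond_distr_def del: vimage_eq Int_iff)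
    also have "{\<omega> \<in> space P. X3 \<omega> \<in> f -` A \<inter> space M3 \<and> Y \<omega> \<in> B} =
        {\<omega> \<in> space P. X4 \<omega> \<in> A \<and> Y \<omega> \<in> B}"
      using X4_eq measurable_space[OF X3] by auto
    finally show ?thesis .
  qed
  show ?thesis
    unfolding is_kernel_cond_distr_def is_cond_distr_def bind_is_cond_distr[OF P X3 X4 K4]
    by (auto simp: lhs)
qed

theorem theorem3:
  fixes P :: "'w measure"
    and M1 :: "'a measure" and M2 :: "'b measure" and M3 :: "'c measure" and M4 :: "'d measure"
    and X1 :: "'w \<Rightarrow> 'a" and X2 :: "'w \<Rightarrow> 'b" and X3 :: "'w \<Rightarrow> 'c" and X4 :: "'w \<Rightarrow> 'd"
    and f :: "'c \<Rightarrow> 'd"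
    and K1 :: "'c \<Rightarrow> 'a measure" and K2 :: "'c \<Rightarrow> 'b measure" and K4 :: "'c \<Rightarrow> 'd measure"
  assumes "prob_space P"
    and "X1 \<in> P \<rightarrow>\<^sub>M M1" and "X2 \<in> P \<rightarrow>\<^sub>M M2" and "X3 \<in> P \<rightarrow>\<^sub>M M3" and "X4 \<in> P \<rightarrow>\<^sub>M M4"
    and "f \<in> M3 \<rightarrow>\<^sub>M M4"
    and "\<And>\<omega>. \<omega> \<in> space P \<Longrightarrow> X4 \<omega> = f (X3 \<omega>)"
    and "is_cond_distr P M1 X1 M3 X3 K1"
    and "is_cond_distr P M2 X2 M3 X3 K2"
    and "is_cond_distr P M4 X4 M3 X3 K4"
    and "\<exists>K. is_cond_distr P (M1 \<Otimes>\<^sub>M M2) (\<lambda>\<omega>. (X1 \<omega>, X2 \<omega>)) M3 X3 K"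
    and "\<exists>K. is_cond_distr P (M1 \<Otimes>\<^sub>M M2) (\<lambda>\<omega>. (X1 \<omega>, X2 \<omega>)) M4 X4 K"
    and "\<exists>K. is_cond_distr P M1 X1 M4 X4 K"
    and "\<exists>K. is_cond_distr P M2 X2 M4 X4 K"
    and "\<exists>L. is_kernel_cond_distr (distr P M3 X3) (M1 \<Otimes>\<^sub>M M2) (diag_prod K1 K2) M4 K4 L"
    and "\<exists>L. is_kernel_cond_distr (distr P M3 X3) M1 K1 M4 K4 L"
    and "\<exists>L. is_kernel_cond_distr (distr P M3 X3) M2 K2 M4 K4 L"
  shows "cond_indep_rv P M1 X1 M2 X2 M3 X3 \<Longrightarrow>
    cond_indep_rv P M1 X1 M2 X2 M4 X4 \<longleftrightarrow> cond_indep_kernel (distr P M3 X3) M1 K1 M2 K2 M4 K4"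
proof -
  assume indep: "cond_indep_rv P M1 X1 M2 X2 M3 X3"
  have same_versions: "is_kernel_cond_distr (distr P M3 X3) MY K M4 K4 L \<longleftrightarrow> is_cond_distr P MY Y M4 X4 L"
    if "is_cond_distr P MY Y M3 X3 K" for MY :: "'y measure" and Y K L
    using assms(1,4,5,6,7,10) that by (rule is_kernel_cond_distr_iff_is_cond_distr)
  note K12 = cond_indep_rv_imp_is_cond_distr_diag_prod[OF assms(1,4) indep assms(8,9)]
  show "cond_indep_rv P M1 X1 M2 X2 M4 X4 \<longleftrightarrow> cond_indep_kernel (distr P M3 X3) M1 K1 M2 K2 M4 K4"
    unfolding cond_indep_rv_def cond_indep_kernel_def
      same_versions[OF assms(8)] same_versions[OF assms(9)] same_versions[OF K12]
      bind_is_cond_distr[OF assms(1,4,5,10)] ..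
qed

end
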